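(* Let $\beta>0$ and let $X$ have the exponential distribution with parameter $\beta$, whose range is the set of non-negative real numbers, with probability density function $f(x)=\beta e^{-\beta x}$ on that range. Then the first-order, complementary and second-order loss functions of $X$, as functions of $r$, are $$L_1(r)=\frac{e^{-\beta r}}{\beta},\qquad L_c(r)=r-\left[\frac{1-e^{-\beta r}}{\beta}\right],\qquad L_2(r)=\frac{e^{-\beta r}}{\beta^2}.$$
   Context: For a continuous random variable $X$ with probability density function $f$ (taken to be zero outside the range of $X$), the first-order loss function is $L_1(r)=\mathbb{E}[[X-r]^+]=\int_r^\infty(x-r)f(x)\,dx$, the complementary loss function is $L_c(r)=\mathbb{E}[[X-r]^-]=\int_{-\infty}^r(r-x)f(x)\,dx$, and the second-order loss function is $L_2(r)=\frac12\int_r^\infty(x-r)^2f(x)\,dx$. Here $[y]^+=\max(y,0)$ and $[y]^-=\max(-y,0)$.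
   Formalization: The three formulas are stated for r ≥ 0 only (r in the range of X); for r < 0 they are false, e.g. with β = 1 and r = −1 one has L_1(r) = 2, not e, and L_c(r) = 0, not e − 2. *)

theory Defs
  imports "HOL-Probability.Probability"
begin

text \<open>
  A continuous random variable on a probability space \<^term>\<open>M\<close> is given by \<^term>\<open>X\<close>
  together with a density \<^term>\<open>f\<close>, extended by zero outside the range of \<^term>\<open>X\<close>
  (\<^term>\<open>distributed M lborel X f\<close>). The positive part of \<open>y\<close> is \<open>max y 0\<close>, its negative
  part \<open>max (- y) 0\<close>.
\<close>

definition first_order_loss :: "'a measure \<Rightarrow> ('a \<Rightarrow> real) \<Rightarrow> real \<Rightarrow> real" where
  "first_order_loss M X r = (\<integral>\<omega>. max (X \<omega> - r) 0 \<partial>M)"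

definition complementary_loss :: "'a measure \<Rightarrow> ('a \<Rightarrow> real) \<Rightarrow> real \<Rightarrow> real" where
  "complementary_loss M X r = (\<integral>\<omega>. max (- (X \<omega> - r)) 0 \<partial>M)"

text \<open>Unlike the other two, this one is defined directly from the density.\<close>

definition second_order_loss :: "(real \<Rightarrow> real) \<Rightarrow> real \<Rightarrow> real" where
  "second_order_loss f r = 1 / 2 * (LINT x:{r..}|lborel. (x - r)\<^sup>2 * f x)"

lemma first_order_loss_density:
  assumes "distributed M lborel X (\<lambda>x. ennreal (f x))" "f \<in> borel_measurable borel" "\<And>x. 0 \<le> f x"
  shows "first_order_loss M X r = (LINT x:{r..}|lborel. (x - r) * f x)"
proof -
  have "first_order_loss M X r = (\<integral>x. f x * max (x - r) 0 \<partial>lborel)"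
    unfolding first_order_loss_def
    by (rule distributed_integral[OF assms(1), symmetric]) (use assms in auto)
  also have "\<dots> = (LINT x:{r..}|lborel. (x - r) * f x)"
    unfolding set_lebesgue_integral_def
    by (rule Bochner_Integration.integral_cong) (auto simp: indicator_def max_def)
  finally show ?thesis .
qed

lemma complementary_loss_density:
  assumes "distributed M lborel X (\<lambda>x. ennreal (f x))" "f \<in> borel_measurable borel" "\<And>x. 0 \<le> f x"
  shows "complementary_loss M X r = (LINT x:{..r}|lborel. (r - x) * f x)"
proof -
  have "complementary_loss M X r = (\<integral>x. f x * max (- (x - r)) 0 \<partial>lborel)"
    unfolding complementary_loss_def
    by (rule distributed_integral[OF assms(1), symmetric]) (use assms in auto)
  also have "\<dots> = (LINT x:{..r}|lborel. (r - x) * f x)"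
    unfolding set_lebesgue_integral_def
    by (rule Bochner_Integration.integral_cong) (auto simp: indicator_def max_def)
  finally show ?thesis .
qed

end

(* The exponential density is memoryless: restricted to {r..} and shifted to the origin, it is
   exp (-\<beta> r) times itself. So the k-th upper partial moment about r is exp (-\<beta> r) times the
   k-th moment, which is k!/\<beta>^k. The complementary loss then follows from
   E[(X - r)^-] = E[(X - r)^+] - E[X] + r. *)
theory Submission
  imports Defs
begin

text \<open>The exponential density is the Erlang density of shape 0, whose moments are known as
  nonnegative integrals.\<close>

lemma exponential_density_moment:
  assumes "\<beta> > 0"
  shows "(LINT x|lborel. exponential_density \<beta> x * x ^ k) = fact k / \<beta> ^ k"
proof -
  \<comment> \<open>For odd \<open>k\<close> the power is negative on the negative axis, but the
    density vanishes there.\<close>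
  have "AE x in lborel. 0 \<le> exponential_density \<beta> x * x ^ k"
    using assms by (auto simp: exponential_density_def)
  then show ?thesis
    using nn_integral_erlang_ith_moment[OF assms, of 0 k] assms
    by (subst integral_eq_nn_integral) simp_all
qed

lemma exponential_density_upper_partial_moment:
  assumes "\<beta> > 0" "r \<ge> 0"
  shows "(LINT x:{r..}|lborel. (x - r) ^ k * exponential_density \<beta> x)
    = exp (- \<beta> * r) * fact k / \<beta> ^ k"
proof -
  \<comment> \<open>Substitute \<open>x = r + y\<close>: the indicator of \<open>{r..}\<close>
    becomes that of \<open>y \<ge> 0\<close>, the support of the density. There
    \<open>r \<ge> 0\<close> gives \<open>r + y \<ge> 0\<close>, so the density at
    \<open>r + y\<close> is also given by its exponential formula and the factor
    \<open>exp (- \<beta> * r)\<close> splits off.\<close>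
  have "(LINT x:{r..}|lborel. (x - r) ^ k * exponential_density \<beta> x)
      = (LINT y|lborel. exp (- \<beta> * r) * (exponential_density \<beta> y * y ^ k))"
    unfolding set_lebesgue_integral_def
    by (subst lborel_integral_real_affine[where c = 1 and t = r])
      (use assms in \<open>auto intro!: Bochner_Integration.integral_cong
        simp: exponential_density_def indicator_def exp_add[symmetric] algebra_simps\<close>)
  also have "\<dots> = exp (- \<beta> * r) * fact k / \<beta> ^ k"
    using exponential_density_moment[OF assms(1), of k] by simp
  finally show ?thesis .
qed

lemma (in prob_space) complementary_loss_eq_first_order_loss:
  assumes "integrable M X"
  shows "complementary_loss M X r = first_order_loss M X r - expectation X + r"
proof -
  have "complementary_loss M X r = (\<integral>\<omega>. max (X \<omega> - r) 0 - X \<omega> + r \<partial>M)"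
    unfolding complementary_loss_def
    by (rule Bochner_Integration.integral_cong) (auto simp: max_def)
  \<comment> \<open>Integrability of \<open>X\<close> passes to the positive part, so the integral
    splits; total mass 1 makes \<open>r\<close> integrate to itself.\<close>
  also have "\<dots> = first_order_loss M X r - expectation X + r"
    using assms by (simp add: first_order_loss_def prob_space)
  finally show ?thesis .
qed

theorem mainTheorem8:
  fixes M :: "'a measure" and X :: "'a \<Rightarrow> real" and \<beta> :: real
  assumes "prob_space M"
    and "\<beta> > 0"
    and "distributed M lborel X (exponential_density \<beta>)"
  shows "\<forall>r\<ge>0. first_order_loss M X r = exp (- \<beta> * r) / \<beta>
    \<and> complementary_loss M X r = r - (1 - exp (- \<beta> * r)) / \<beta>
    \<and> second_order_loss (exponential_density \<beta>) r = exp (- \<beta> * r) / \<beta>\<^sup>2"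
proof (intro allI impI)
  fix r :: real
  assume r: "r \<ge> 0"
  interpret prob_space M by fact
  note partial_moment = exponential_density_upper_partial_moment[OF assms(2) r]
  have L1: "first_order_loss M X r = exp (- \<beta> * r) / \<beta>"
    using partial_moment[of 1] assms(2)
    by (simp add: first_order_loss_density[OF assms(3)] exponential_density_nonneg)
  have "integrable M X"
    using erlang_ith_moment_integrable[OF assms(2,3), of 1] by simp
  \<comment> \<open>Here the mean \<open>1 / \<beta>\<close> enters.\<close>
  then have Lc: "complementary_loss M X r = r - (1 - exp (- \<beta> * r)) / \<beta>"
    using L1 exponential_distributed_expectation[OF assms(2,3)]
    by (simp add: complementary_loss_eq_first_order_loss diff_divide_distrib)
  \<comment> \<open>The factor \<open>fact 2 = 2\<close> cancels the \<open>1 / 2\<close> in the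
    definition.\<close>
  have "second_order_loss (exponential_density \<beta>) r = exp (- \<beta> * r) / \<beta>\<^sup>2"
    using partial_moment[of 2] by (simp add: second_order_loss_def)
  with L1 Lc show "first_order_loss M X r = exp (- \<beta> * r) / \<beta>
    \<and> complementary_loss M X r = r - (1 - exp (- \<beta> * r)) / \<beta>
    \<and> second_order_loss (exponential_density \<beta>) r = exp (- \<beta> * r) / \<beta>\<^sup>2"
    by blast
qed

end
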